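(* Let $k\ge 1$ be an integer. Each $6k$-vertex jumble ladder $G$ has a lacunar 3-total-perfect semi-total coloring (sTC) $\mu$ for which there is no $\beta$-reduction of $\mu$ to a total coloring (TC). Moreover, such a lacunar 3-total-perfect sTC $\mu$ is equitable only if $k=1$, meaning that $K_{3,3}=Mob_3$ is the only jumble ladder with a lacunar 3-total-perfect sTC that is equitable.
   Context: Jumble ladders. Let $k\ge1$ and let $C=(u_1,v_1,w_1,u_2,v_2,w_2,\ldots,u_{2k},v_{2k},w_{2k})$ be a cycle of length $6k$. A $6k$-vertex jumble ladder is a cubic simple graph $G$ whose edge set is the union of the edges of the Hamilton cycle $C$ and a 1-factor $F=F_u\cup F_v\cup F_w$, where, for each $z\in\{u,v,w\}$, $F_z$ is a perfect matching (a set of $k$ disjoint pairs) on the vertex set $\{z_1,\ldots,z_{2k}\}$. If each $F_z$ consists of the pairs $z_jz_{j+k}$, $1\le j\le k$, then $G$ is the Möbius ladder $Mob_{3k}$, where for $r>2$ the Möbius ladder $Mob_r$ is the graph obtained from the cycle $C_{2r}$ by adding the edges joining opposite vertices. Colorings. For a cubic graph $G$ a set of four colors $\chi(3)=\{0,1,2,3\}$ is used. A semi-total coloring (sTC) of $G$ is a function $\mu:V(G)\cup E(G)\to\chi(3)$ such that every two adjacent edges have distinct colors and every vertex has a color distinct from the colors of its incident edges. A total coloring (TC) is an sTC in which, in addition, adjacent vertices have distinct colors. The $\mu$-class of a color is the set of vertices and edges with that color; $\mu$ is equitable if the cardinalities of every two of the four $\mu$-classes differ by at most 1. An sTC is lacunar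 if some color $c\in\chi(3)$ is assigned to no vertex. A $\beta$-edge of $\mu$ is an edge whose endvertices have the same color; $\beta(\mu)$ is the number of $\beta$-edges. A total perfect code of a graph $G=(V,E)$ is a set $S\subseteq V$ such that $|N(v)\cap S|=1$ for all $v\in V$, where $N(v)$ is the open neighborhood of $v$. A lacunar sTC $\mu$ of a cubic graph is 3-total-perfect if the vertex sets of the nonempty color classes (of vertices) form three total perfect codes formed by the endvertices of the $\beta$-edges. $\beta$-reductions. A color alternating path with respect to $\mu$ is a path $S=(v_0,e_1,v_1,\ldots,e_k,v_k)$ in $G$ (of some length $k\geq1$) for which there are distinct colors $c_0,c_1$ with $\mu(v_0)=c_0$, $\mu(e_i)=c_1$ for odd $i$, $\mu(e_i)=c_0$ for even $i$, and $\mu(v_k)\in\{c_0,c_1\}\setminus\{\mu(e_k)\}$ (colors of interior vertices are arbitrary). It is a maximal color alternating path (MCAP) if no path having $S$ as a shorter subpath is a color alternating path with respect to $\mu$. Given an MCAP $S$, let $\mu'$ be the sTC obtained from $\mu$ by exchanging the colors $c_0$ and $c_1$ on $v_0,e_1,e_2,\ldots,e_k,v_k$ and leaving all other colors unchanged. If $\beta(\mu')\le\beta(\mu)$, then $\mu'$ is a $\beta$-reduction of $\mu$ (with respect to $S$), called partial if $\beta(\mu')>0$ and total if $\beta(\mu')=0$; in the latter case $\mu'$ is a TC. *)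

theory Defs
  imports
    "HOL-Library.Disjoint_Sets"
    "HOL-Library.Sublist"
    "HOL-Library.FuncSet"
    "HOL-Combinatorics.Transposition"
begin

section \<open>Simple graphs\<close>

record 'a graph =
  verts :: "'a set"
  edges :: "'a set set"

definition simple_graph :: "'a graph \<Rightarrow> bool" where
  "simple_graph G \<longleftrightarrow>
     finite (verts G) \<and> (\<forall>e\<in>edges G. e \<subseteq> verts G \<and> card e = 2)"

definition open_nbhd :: "'a graph \<Rightarrow> 'a \<Rightarrow> 'a set" where
  "open_nbhd G v = {w \<in> verts G. {v, w} \<in> edges G}"

definition cubic :: "'a graph \<Rightarrow> bool" where
  "cubic G \<longleftrightarrow> (\<forall>v\<in>verts G. card (open_nbhd G v) = 3)"

definition graph_iso :: "'a graph \<Rightarrow> 'b graph \<Rightarrow> bool" where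
  "graph_iso G H \<longleftrightarrow>
     (\<exists>f. bij_betw f (verts G) (verts H) \<and> (`) f ` edges G = edges H)"

definition complete_bipartite :: "nat \<Rightarrow> nat \<Rightarrow> (nat + nat) graph" where
  "complete_bipartite m n =
     \<lparr> verts = {..<m} <+> {..<n},
       edges = {{Inl i, Inr j} | i j. i < m \<and> j < n} \<rparr>"

text \<open>The edges of the cycle \<open>x 0, x 1, \<dots>, x (n - 1), x 0\<close>.\<close>

definition cycle_edges :: "nat \<Rightarrow> (nat \<Rightarrow> 'a) \<Rightarrow> 'a set set" where
  "cycle_edges n x = {{x i, x (Suc i mod n)} | i. i < n}"

text \<open>Intended for \<open>r > 2\<close> only.\<close>

definition mobius_ladder :: "nat \<Rightarrow> nat graph" where
  "mobius_ladder r =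
     \<lparr> verts = {..<2 * r},
       edges = cycle_edges (2 * r) (\<lambda>i. i) \<union> {{i, i + r} | i. i < r} \<rparr>"

definition perfect_matching_on :: "'a set \<Rightarrow> 'a set set \<Rightarrow> bool" where
  "perfect_matching_on A M \<longleftrightarrow> partition_on A M \<and> (\<forall>e\<in>M. card e = 2)"

text \<open>
  The Hamilton cycle \<open>(u\<^sub>1, v\<^sub>1, w\<^sub>1, \<dots>, u\<^sub>2\<^sub>k, v\<^sub>2\<^sub>k, w\<^sub>2\<^sub>k)\<close> is the sequence
  \<open>x 0, \<dots>, x (6 * k - 1)\<close>; thus \<open>u\<^sub>j = x (3 * (j - 1))\<close>, \<open>v\<^sub>j = x (3 * (j - 1) + 1)\<close>
  and \<open>w\<^sub>j = x (3 * (j - 1) + 2)\<close>, so that the \<open>u\<close>-, \<open>v\<close>- and \<open>w\<close>-vertices are those at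
  positions congruent to 0, 1 and 2 modulo 3.
\<close>

definition jumble_ladder :: "nat \<Rightarrow> 'a graph \<Rightarrow> bool" where
  "jumble_ladder k G \<longleftrightarrow>
     1 \<le> k \<and> simple_graph G \<and> cubic G \<and>
     (\<exists>x Fu Fv Fw.
        bij_betw x {..<6 * k} (verts G) \<and>
        perfect_matching_on (x ` {i. i < 6 * k \<and> i mod 3 = 0}) Fu \<and>
        perfect_matching_on (x ` {i. i < 6 * k \<and> i mod 3 = 1}) Fv \<and>
        perfect_matching_on (x ` {i. i < 6 * k \<and> i mod 3 = 2}) Fw \<and>
        edges G = cycle_edges (6 * k) x \<union> (Fu \<union> Fv \<union> Fw))"


section \<open>Semi-total and total colorings\<close>

text \<open>
  A coloring acts on the disjoint union of vertices and edges: \<open>\<mu> (Inl v)\<close> is the color of the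
  vertex \<open>v\<close> and \<open>\<mu> (Inr e)\<close> that of the edge \<open>e\<close>. Its values outside
  \<open>verts G <+> edges G\<close> are irrelevant.
\<close>

type_synonym 'a coloring = "'a + 'a set \<Rightarrow> nat"

definition colors :: "nat set" where
  "colors = {0, 1, 2, 3}"

definition semi_total_coloring :: "'a graph \<Rightarrow> 'a coloring \<Rightarrow> bool" where
  "semi_total_coloring G \<mu> \<longleftrightarrow>
     \<mu> \<in> verts G <+> edges G \<rightarrow> colors \<and>
     (\<forall>e\<in>edges G. \<forall>f\<in>edges G. e \<noteq> f \<and> e \<inter> f \<noteq> {} \<longrightarrow> \<mu> (Inr e) \<noteq> \<mu> (Inr f)) \<and>
     (\<forall>v\<in>verts G. \<forall>e\<in>edges G. v \<in> e \<longrightarrow> \<mu> (Inl v) \<noteq> \<mu> (Inr e))"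

definition total_coloring :: "'a graph \<Rightarrow> 'a coloring \<Rightarrow> bool" where
  "total_coloring G \<mu> \<longleftrightarrow>
     semi_total_coloring G \<mu> \<and>
     (\<forall>u v. {u, v} \<in> edges G \<longrightarrow> \<mu> (Inl u) \<noteq> \<mu> (Inl v))"

definition color_class :: "'a graph \<Rightarrow> 'a coloring \<Rightarrow> nat \<Rightarrow> ('a + 'a set) set" where
  "color_class G \<mu> c = {x \<in> verts G <+> edges G. \<mu> x = c}"

definition equitable :: "'a graph \<Rightarrow> 'a coloring \<Rightarrow> bool" where
  "equitable G \<mu> \<longleftrightarrow>
     (\<forall>c\<in>colors. \<forall>d\<in>colors. card (color_class G \<mu> c) \<le> card (color_class G \<mu> d) + 1)"

definition lacunar :: "'a graph \<Rightarrow> 'a coloring \<Rightarrow> bool" where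
  "lacunar G \<mu> \<longleftrightarrow>
     semi_total_coloring G \<mu> \<and> (\<exists>c\<in>colors. \<forall>v\<in>verts G. \<mu> (Inl v) \<noteq> c)"

definition beta_edges :: "'a graph \<Rightarrow> 'a coloring \<Rightarrow> 'a set set" where
  "beta_edges G \<mu> = {e \<in> edges G. \<forall>u\<in>e. \<forall>v\<in>e. \<mu> (Inl u) = \<mu> (Inl v)}"

definition beta :: "'a graph \<Rightarrow> 'a coloring \<Rightarrow> nat" where
  "beta G \<mu> = card (beta_edges G \<mu>)"

definition total_perfect_code :: "'a graph \<Rightarrow> 'a set \<Rightarrow> bool" where
  "total_perfect_code G S \<longleftrightarrow>
     S \<subseteq> verts G \<and> (\<forall>v\<in>verts G. card (open_nbhd G v \<inter> S) = 1)"

definition vertex_classes :: "'a graph \<Rightarrow> 'a coloring \<Rightarrow> 'a set set" where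
  "vertex_classes G \<mu> = {{v \<in> verts G. \<mu> (Inl v) = c} | c. c \<in> colors} - {{}}"

definition three_total_perfect :: "'a graph \<Rightarrow> 'a coloring \<Rightarrow> bool" where
  "three_total_perfect G \<mu> \<longleftrightarrow>
     lacunar G \<mu> \<and>
     card (vertex_classes G \<mu>) = 3 \<and>
     (\<forall>S\<in>vertex_classes G \<mu>.
        total_perfect_code G S \<and> S = \<Union>{e \<in> beta_edges G \<mu>. e \<subseteq> S})"


section \<open>Color alternating paths and reductions\<close>

text \<open>
  The path \<open>(v\<^sub>0, e\<^sub>1, v\<^sub>1, \<dots>, e\<^sub>n, v\<^sub>n)\<close> is represented by its list of vertices \<open>p\<close>;
  then \<open>v\<^sub>i = p ! i\<close>, \<open>e\<^sub>i = path_edge p i\<close> for \<open>1 \<le> i \<le> n\<close>, and \<open>n = path_length p\<close>.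
\<close>

definition path_length :: "'a list \<Rightarrow> nat" where
  "path_length p = length p - 1"

definition path_edge :: "'a list \<Rightarrow> nat \<Rightarrow> 'a set" where
  "path_edge p i = {p ! (i - 1), p ! i}"

definition is_path :: "'a graph \<Rightarrow> 'a list \<Rightarrow> bool" where
  "is_path G p \<longleftrightarrow>
     p \<noteq> [] \<and> distinct p \<and> set p \<subseteq> verts G \<and>
     (\<forall>i\<in>{1..path_length p}. path_edge p i \<in> edges G)"

definition color_alternating ::
  "'a graph \<Rightarrow> 'a coloring \<Rightarrow> nat \<Rightarrow> nat \<Rightarrow> 'a list \<Rightarrow> bool" where
  "color_alternating G \<mu> c\<^sub>0 c\<^sub>1 p \<longleftrightarrow>
     is_path G p \<and> path_length p \<ge> 1 \<and>
     c\<^sub>0 \<in> colors \<and> c\<^sub>1 \<in> colors \<and> c\<^sub>0 \<noteq> c\<^sub>1 \<and>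
     \<mu> (Inl (hd p)) = c\<^sub>0 \<and>
     (\<forall>i\<in>{1..path_length p}. \<mu> (Inr (path_edge p i)) = (if odd i then c\<^sub>1 else c\<^sub>0)) \<and>
     \<mu> (Inl (last p)) \<in> {c\<^sub>0, c\<^sub>1} - {\<mu> (Inr (path_edge p (path_length p)))}"

definition color_alternating_path :: "'a graph \<Rightarrow> 'a coloring \<Rightarrow> 'a list \<Rightarrow> bool" where
  "color_alternating_path G \<mu> p \<longleftrightarrow> (\<exists>c\<^sub>0 c\<^sub>1. color_alternating G \<mu> c\<^sub>0 c\<^sub>1 p)"

text \<open>
  Subpaths are contiguous sublists. For a semi-total coloring the reverse of a color alternating
  path is again one, so it does not matter in which direction a longer path is traversed.
\<close>

definition maximal_color_alternating_path ::
  "'a graph \<Rightarrow> 'a coloring \<Rightarrow> 'a list \<Rightarrow> bool" where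
  "maximal_color_alternating_path G \<mu> p \<longleftrightarrow>
     color_alternating_path G \<mu> p \<and>
     \<not> (\<exists>q. strict_sublist p q \<and> color_alternating_path G \<mu> q)"

text \<open>Interior vertices of the path keep their color.\<close>

definition exchange_on_path ::
  "nat \<Rightarrow> nat \<Rightarrow> 'a list \<Rightarrow> 'a coloring \<Rightarrow> 'a coloring" where
  "exchange_on_path c\<^sub>0 c\<^sub>1 p \<mu> = (\<lambda>x.
     if x \<in> {Inl (hd p), Inl (last p)} \<union> Inr ` path_edge p ` {1..path_length p}
     then transpose c\<^sub>0 c\<^sub>1 (\<mu> x) else \<mu> x)"

definition beta_reduction :: "'a graph \<Rightarrow> 'a coloring \<Rightarrow> 'a coloring \<Rightarrow> bool" where
  "beta_reduction G \<mu> \<mu>' \<longleftrightarrow>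
     (\<exists>p c\<^sub>0 c\<^sub>1. maximal_color_alternating_path G \<mu> p \<and>
        color_alternating G \<mu> c\<^sub>0 c\<^sub>1 p \<and>
        \<mu>' = exchange_on_path c\<^sub>0 c\<^sub>1 p \<mu> \<and>
        beta G \<mu>' \<le> beta G \<mu>)"

end

theory Submission
  imports Defs
begin

text \<open>
  In a jumble ladder, give a vertex at position \<open>i\<close> of the Hamilton cycle the class \<open>i mod 3\<close>. Its
  two neighbors on the cycle lie in the two other classes, and its partner in the 1-factor lies in
  its own class, so each of the three classes is a total perfect code. Any such partition of a
  cubic graph determines a 3-total-perfect coloring: vertices get their class in \<open>{0, 1, 2}\<close>, edges
  inside a class get the color 3, and an edge between two classes gets the third class
  (\<open>tri_coloring_three_total_perfect\<close>).

  No reduction of a 3-total-perfect coloring is a total coloring. Along a path only the two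
  endvertices change color, so one of the three vertex classes keeps its colors, and with them a
  \<open>\<beta>\<close>-edge (\<open>three_total_perfect_no_total_reduction\<close>).

  Whether the coloring is equitable is a matter of counting. In a cubic graph each vertex sees each
  of the four colors exactly once, on itself or on an incident edge. Hence the edges of color \<open>c\<close>
  perfectly match the vertices that do not have color \<open>c\<close>, and the color class has half as many
  elements as there are vertices, counting those of color \<open>c\<close> twice. A total perfect code contains
  a third of the \<open>6k\<close> vertices, so the three colors on vertices have classes of size \<open>4k\<close> and the
  missing color has a class of size \<open>3k\<close>. These differ by at most 1 exactly when \<open>k = 1\<close>
  (\<open>three_total_perfect_equitable_iff\<close>).

  For \<open>k = 1\<close> each class has two vertices, which leaves only one perfect matching: it joins opposite
  vertices of a hexagon, which is the Moebius ladder on six vertices. Since \<open>K\<^sub>3\<^sub>,\<^sub>3\<close> is itself a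
  jumble ladder with \<open>k = 1\<close>, all the isomorphisms follow from this.
\<close>


section \<open>Counting in cubic graphs\<close>

lemma cubic_card_incident_edges:
  assumes "simple_graph G" "cubic G" "v \<in> verts G"
  shows "card {e \<in> edges G. v \<in> e} = 3"
proof -
  have "{e \<in> edges G. v \<in> e} = (\<lambda>w. {v, w}) ` open_nbhd G v"
  proof (intro equalityI subsetI)
    fix e assume e: "e \<in> {e \<in> edges G. v \<in> e}"
    then have sub: "e \<subseteq> verts G" and "card e = 2"
      using assms(1) by (auto simp: simple_graph_def)
    then obtain a b where ab: "e = {a, b}"
      by (auto simp: card_2_iff)
    define w where "w = (if v = a then b else a)"
    have "e = {v, w}"
      using e ab by (auto simp: w_def)
    then show "e \<in> (\<lambda>w. {v, w}) ` open_nbhd G v"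
      using e sub by (auto simp: open_nbhd_def)
  qed (auto simp: open_nbhd_def)
  moreover have "inj_on (\<lambda>w. {v, w}) (open_nbhd G v)"
    by (auto simp: inj_on_def doubleton_eq_iff)
  ultimately show ?thesis
    using assms by (simp add: card_image cubic_def)
qed

lemma simple_graph_finite_edges:
  assumes "simple_graph G"
  shows "finite (edges G)"
proof (rule finite_subset)
  show "edges G \<subseteq> Pow (verts G)" "finite (Pow (verts G))"
    using assms by (auto simp: simple_graph_def)
qed

lemma perfect_matching_card:
  assumes "finite A" "perfect_matching_on A M"
  shows "card A = 2 * card M"
proof -
  have part: "partition_on A M" and two: "\<forall>e\<in>M. card e = 2"
    using assms(2) by (auto simp: perfect_matching_on_def)
  have "card A = (\<Sum>e\<in>M. card e)"
    unfolding partition_onD1[OF part] using partition_onD2[OF part] finite_elements[OF assms(1) part]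
    by (intro card_Union_disjoint)
      (use two in \<open>auto simp: disjoint_def pairwise_def disjnt_def intro: card_ge_0_finite\<close>)
  then show ?thesis
    using two by simp
qed

text \<open>
  In the last rule, equality of colors is a premise: at each vertex \<open>v\<close>, a color identifies at most
  one edge.
\<close>

lemma semi_total_coloringD:
  assumes "semi_total_coloring G \<mu>"
  shows "v \<in> verts G \<Longrightarrow> \<mu> (Inl v) \<in> colors"
    and "e \<in> edges G \<Longrightarrow> \<mu> (Inr e) \<in> colors"
    and "v \<in> verts G \<Longrightarrow> e \<in> edges G \<Longrightarrow> v \<in> e \<Longrightarrow> \<mu> (Inl v) \<noteq> \<mu> (Inr e)"
    and "e \<in> edges G \<Longrightarrow> f \<in> edges G \<Longrightarrow> v \<in> e \<Longrightarrow> v \<in> f \<Longrightarrow>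
      \<mu> (Inr e) = \<mu> (Inr f) \<Longrightarrow> e = f"
proof -
  note stc = assms[unfolded semi_total_coloring_def]
  note P = stc[THEN conjunct1] and Q = stc[THEN conjunct2, THEN conjunct1]
    and R = stc[THEN conjunct2, THEN conjunct2]
  show "v \<in> verts G \<Longrightarrow> \<mu> (Inl v) \<in> colors" "e \<in> edges G \<Longrightarrow> \<mu> (Inr e) \<in> colors"
    using P by blast+
  show "v \<in> verts G \<Longrightarrow> e \<in> edges G \<Longrightarrow> v \<in> e \<Longrightarrow> \<mu> (Inl v) \<noteq> \<mu> (Inr e)"
    using R by blast
  show "e \<in> edges G \<Longrightarrow> f \<in> edges G \<Longrightarrow> v \<in> e \<Longrightarrow> v \<in> f \<Longrightarrow>
      \<mu> (Inr e) = \<mu> (Inr f) \<Longrightarrow> e = f"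
    using Q by blast
qed

text \<open>
  The vertex and its three edges have pairwise distinct colors, and there are only four colors.
\<close>

lemma semi_total_coloring_all_colors_at_vertex:
  assumes "simple_graph G" "cubic G" "semi_total_coloring G \<mu>" "v \<in> verts G"
    and "c \<in> colors" "\<mu> (Inl v) \<noteq> c"
  shows "\<exists>e\<in>edges G. v \<in> e \<and> \<mu> (Inr e) = c"
proof -
  let ?I = "{e \<in> edges G. v \<in> e}"
  let ?T = "insert (Inl v) (Inr ` ?I)"
  have fin: "finite ?I"
    using simple_graph_finite_edges[OF assms(1)] by simp
  have "card ?T = 4"
    using cubic_card_incident_edges[OF assms(1,2,4)] fin
    by (subst card_insert_disjoint) (auto simp: card_image)
  moreover have "inj_on \<mu> ?T"
  proof -
    have "inj_on \<mu> (Inr ` ?I)"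
      using semi_total_coloringD(4)[OF assms(3)] unfolding inj_on_def by blast
    moreover have "\<mu> (Inl v) \<notin> \<mu> ` Inr ` ?I"
      using semi_total_coloringD(3)[OF assms(3,4)] by blast
    ultimately show ?thesis
      by auto
  qed
  ultimately have "card (\<mu> ` ?T) = 4"
    by (simp only: card_image)
  moreover have "\<mu> ` ?T \<subseteq> colors"
    using semi_total_coloringD(1,2)[OF assms(3)] assms(4) by blast
  ultimately have "\<mu> ` ?T = colors"
    using card_subset_eq[of colors "\<mu> ` ?T"] by (simp only:) (simp add: colors_def)
  then have "c \<in> \<mu> ` ?T"
    using assms(5) by simp
  with assms(6) show ?thesis
    by auto
qed

text \<open>
  The edges of color \<open>c\<close> form a perfect matching on the vertices of the other colors, so
  \<open>2|E\<^sub>c| = |V| - |V\<^sub>c|\<close>, and the class has \<open>|V\<^sub>c| + |E\<^sub>c|\<close> elements.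
\<close>

lemma card_color_class_cubic:
  assumes "simple_graph G" "cubic G" "semi_total_coloring G \<mu>" "c \<in> colors"
  shows "2 * card (color_class G \<mu> c) = card (verts G) + card {v \<in> verts G. \<mu> (Inl v) = c}"
proof -
  let ?V = "{v \<in> verts G. \<mu> (Inl v) = c}"
  let ?E = "{e \<in> edges G. \<mu> (Inr e) = c}"
  have finV: "finite (verts G)"
    using assms(1) by (simp add: simple_graph_def)
  have "perfect_matching_on (verts G - ?V) ?E"
    unfolding perfect_matching_on_def partition_on_def disjoint_def
  proof (intro conjI ballI impI)
    show "\<Union> ?E = verts G - ?V"
    proof (intro equalityI subsetI)
      fix v assume "v \<in> \<Union> ?E"
      then obtain e where e: "e \<in> edges G" "\<mu> (Inr e) = c" "v \<in> e"
        by blast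
      then have "v \<in> verts G"
        using assms(1) by (auto simp: simple_graph_def)
      then show "v \<in> verts G - ?V"
        using semi_total_coloringD(3)[OF assms(3) _ e(1,3)] e(2) by auto
    next
      fix v assume "v \<in> verts G - ?V"
      then show "v \<in> \<Union> ?E"
        using semi_total_coloring_all_colors_at_vertex[OF assms(1-3) _ assms(4), of v] by auto
    qed
  next
    fix e f assume "e \<in> ?E" "f \<in> ?E" "e \<noteq> f"
    then show "e \<inter> f = {}"
      using semi_total_coloringD(4)[OF assms(3), of e f] by (simp add: disjoint_iff) metis
  next
    fix e assume "e \<in> ?E"
    then show "card e = 2"
      using assms(1) by (simp add: simple_graph_def)
  next
    show "{} \<notin> ?E"
      using assms(1)
      by (metis (mono_tags, lifting) card.empty mem_Collect_eq simple_graph_def zero_neq_numeral)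
  qed
  then have "card (verts G - ?V) = 2 * card ?E"
    using finV by (intro perfect_matching_card) auto
  moreover have "card (verts G - ?V) = card (verts G) - card ?V" "card ?V \<le> card (verts G)"
    using finV by (simp_all add: card_Diff_subset card_mono)
  moreover have "color_class G \<mu> c = ?V <+> ?E"
    unfolding color_class_def Plus_def by blast
  ultimately show ?thesis
    using finV simple_graph_finite_edges[OF assms(1)] by (simp add: card_Plus)
qed

text \<open>
  Count the pairs of a vertex and a neighbor of it in \<open>S\<close>: one for each vertex, and three for each
  element of \<open>S\<close>.
\<close>

lemma card_total_perfect_code_cubic:
  assumes "finite (verts G)" "cubic G" "total_perfect_code G S"
  shows "3 * card S = card (verts G)"
proof -
  have S: "S \<subseteq> verts G" and one: "\<And>v. v \<in> verts G \<Longrightarrow> card (open_nbhd G v \<inter> S) = 1"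
    using assms(3) by (auto simp: total_perfect_code_def)
  have "(\<Sum>v\<in>verts G. card {s \<in> S. {v, s} \<in> edges G}) = 3 * card S"
  proof (rule sum_multicount)
    show "\<forall>s\<in>S. card {v \<in> verts G. {v, s} \<in> edges G} = 3"
      using assms(2) S by (auto simp: cubic_def open_nbhd_def insert_commute)
  qed (use assms(1) S finite_subset in auto)
  moreover have "{s \<in> S. {v, s} \<in> edges G} = open_nbhd G v \<inter> S" for v
    using S by (auto simp: open_nbhd_def)
  ultimately show ?thesis
    using one by simp
qed

lemma three_total_perfect_class_sizes:
  assumes "simple_graph G" "cubic G" "three_total_perfect G \<mu>" "card (verts G) = 6 * k"
    and "c \<in> colors"
  shows "card (color_class G \<mu> c) = (if \<exists>v\<in>verts G. \<mu> (Inl v) = c then 4 * k else 3 * k)"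
proof -
  let ?V = "{v \<in> verts G. \<mu> (Inl v) = c}"
  have stc: "semi_total_coloring G \<mu>"
    using assms(3) by (simp add: three_total_perfect_def lacunar_def)
  note count = card_color_class_cubic[OF assms(1,2) stc assms(5)]
  show ?thesis
  proof (cases "?V = {}")
    case True
    then have "card ?V = 0" "\<not> (\<exists>v\<in>verts G. \<mu> (Inl v) = c)"
      by (simp_all only: card.empty) blast
    then show ?thesis
      using count assms(4) by simp
  next
    case False
    then have "?V \<in> vertex_classes G \<mu>"
      using assms(5) by (auto simp: vertex_classes_def)
    then have "total_perfect_code G ?V"
      using assms(3) by (auto simp: three_total_perfect_def)
    then have "3 * card ?V = 6 * k"
      using card_total_perfect_code_cubic[of G ?V] assms by (auto simp: simple_graph_def)
    then show ?thesis
      using count assms(4) False by auto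
  qed
qed

text \<open>
  Both sizes \<open>4k\<close> and \<open>3k\<close> occur, the latter for the missing color, and they differ by \<open>k\<close>.
\<close>

lemma three_total_perfect_equitable_iff:
  assumes "simple_graph G" "cubic G" "three_total_perfect G \<mu>" "card (verts G) = 6 * k"
    and "k \<ge> 1"
  shows "equitable G \<mu> \<longleftrightarrow> k = 1"
proof
  assume "k = 1"
  then show "equitable G \<mu>"
    using three_total_perfect_class_sizes[OF assms(1-4)] by (simp add: equitable_def)
next
  assume eq: "equitable G \<mu>"
  obtain c where c: "c \<in> colors" "\<forall>v\<in>verts G. \<mu> (Inl v) \<noteq> c"
    using assms(3) by (auto simp: three_total_perfect_def lacunar_def)
  obtain v where v: "v \<in> verts G"
    using assms(4,5) by (metis card.empty ex_in_conv mult_eq_0_iff not_one_le_zero zero_neq_numeral)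
  then have d: "\<mu> (Inl v) \<in> colors"
    using assms(3)
    by (auto simp: three_total_perfect_def lacunar_def semi_total_coloring_def)
  have "card (color_class G \<mu> (\<mu> (Inl v))) \<le> card (color_class G \<mu> c) + 1"
    using eq c(1) d by (auto simp: equitable_def)
  then have "4 * k \<le> 3 * k + 1"
    using three_total_perfect_class_sizes[OF assms(1-4) c(1)]
      three_total_perfect_class_sizes[OF assms(1-4) d] c(2) v by (simp split: if_splits) blast
  then show "k = 1"
    using assms(5) by simp
qed


section \<open>Reductions reach at most two of the three vertex classes\<close>

text \<open>
  The three vertex classes are disjoint and each contains a \<open>\<beta>\<close>-edge. A class that contains neither
  end of the path keeps its colors, so its \<open>\<beta>\<close>-edges survive the exchange.
\<close>

lemma three_total_perfect_no_total_reduction: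
  assumes "simple_graph G" "three_total_perfect G \<mu>" "beta_reduction G \<mu> \<mu>'"
  shows "\<not> total_coloring G \<mu>'"
proof
  assume tc: "total_coloring G \<mu>'"
  obtain p c\<^sub>0 c\<^sub>1 where \<mu>': "\<mu>' = exchange_on_path c\<^sub>0 c\<^sub>1 p \<mu>"
    using assms(3) by (auto simp: beta_reduction_def)
  let ?class = "\<lambda>a. {v \<in> verts G. \<mu> (Inl v) = \<mu> (Inl a)}"
  have "\<exists>S\<in>vertex_classes G \<mu>. S \<notin> {?class (hd p), ?class (last p)}"
  proof (rule ccontr)
    assume "\<not> ?thesis"
    then have "card (vertex_classes G \<mu>) \<le> card {?class (hd p), ?class (last p)}"
      by (intro card_mono) auto
    also have "\<dots> \<le> 2"
      by (simp add: card_insert_if)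
    finally show False
      using assms(2) by (simp add: three_total_perfect_def)
  qed
  then obtain S where S: "S \<in> vertex_classes G \<mu>" "S \<noteq> ?class (hd p)" "S \<noteq> ?class (last p)"
    by auto
  then obtain d where d: "S = {v \<in> verts G. \<mu> (Inl v) = d}"
    unfolding vertex_classes_def by blast
  have fixed: "\<mu>' (Inl v) = \<mu> (Inl v)" if "v \<in> S" for v
  proof -
    have "v \<noteq> hd p" "v \<noteq> last p"
      using that S(2,3) unfolding d by blast+
    then show ?thesis
      by (simp add: \<mu>' exchange_on_path_def image_iff)
  qed
  have "S \<noteq> {}"
    using S(1) unfolding vertex_classes_def by blast
  moreover have "S = \<Union>{e \<in> beta_edges G \<mu>. e \<subseteq> S}"
    using S(1) assms(2) unfolding three_total_perfect_def by blast
  ultimately obtain e where e: "e \<in> beta_edges G \<mu>" "e \<subseteq> S"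
    by blast
  then have "card e = 2"
    using assms(1) by (simp add: beta_edges_def simple_graph_def)
  then obtain a b where ab: "e = {a, b}"
    by (auto simp: card_2_iff)
  have "{a, b} \<in> edges G" "\<mu> (Inl a) = \<mu> (Inl b)" "a \<in> S" "b \<in> S"
    using e unfolding beta_edges_def ab by blast+
  then have "{a, b} \<in> edges G" "\<mu>' (Inl a) = \<mu>' (Inl b)"
    using fixed by simp_all
  with tc show False
    unfolding total_coloring_def by blast
qed


section \<open>Colorings from partitions into three total perfect codes\<close>

text \<open>
  For an edge \<open>e\<close> between two of the classes \<open>0\<close>, \<open>1\<close>, \<open>2\<close>, the value \<open>3 - \<Sum>(cl ` e)\<close> is the third
  one, as the three sum up to 3. The edges inside a class take the color that no vertex has.
\<close>

definition tri_coloring :: "('a \<Rightarrow> nat) \<Rightarrow> 'a coloring" where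
  "tri_coloring cl x =
     (case x of Inl v \<Rightarrow> cl v
      | Inr e \<Rightarrow> if is_singleton (cl ` e) then 3 else 3 - \<Sum>(cl ` e))"

lemma tri_coloring_vertex [simp]: "tri_coloring cl (Inl v) = cl v"
  by (simp add: tri_coloring_def)

lemma tri_coloring_edge:
  "tri_coloring cl (Inr {v, w}) = (if cl v = cl w then 3 else 3 - (cl v + cl w))"
proof -
  have "is_singleton {cl v, cl w} \<longleftrightarrow> cl v = cl w"
    by (metis insertI1 insert_absorb2 insert_commute is_singletonE is_singletonI singletonD)
  then show ?thesis
    by (simp add: tri_coloring_def)
qed

text \<open>
  In a cubic graph it suffices that every vertex has a neighbor in each of the three classes: its
  three neighbors then lie in different classes, which makes each class a total perfect code. It
  also makes the coloring proper, since the color of an edge at \<open>v\<close> is an injective function of the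
  class of its other end.
\<close>

lemma tri_coloring_three_total_perfect:
  assumes G: "simple_graph G" "cubic G" "verts G \<noteq> {}"
    and range: "\<And>v. v \<in> verts G \<Longrightarrow> cl v < 3"
    and dominating: "\<And>v c. v \<in> verts G \<Longrightarrow> c < 3 \<Longrightarrow> \<exists>w\<in>open_nbhd G v. cl w = c"
  shows "three_total_perfect G (tri_coloring cl)"
proof -
  let ?\<mu> = "tri_coloring cl"
  let ?S = "\<lambda>c. {v \<in> verts G. cl v = c}"
  have edgeE: "\<exists>w\<in>verts G. e = {v, w}" if "e \<in> edges G" "v \<in> e" for e v
  proof -
    have "card e = 2" "e \<subseteq> verts G"
      using that G(1) by (auto simp: simple_graph_def)
    moreover from this obtain a b where "e = {a, b}"
      by (auto simp: card_2_iff)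
    ultimately show ?thesis
      using that(2) by (metis insertE insert_commute insert_subset singletonD)
  qed
  \<comment> \<open>a surjection from the three neighbors onto the three classes\<close>
  have inj: "inj_on cl (open_nbhd G v)" if v: "v \<in> verts G" for v
  proof (rule eq_card_imp_inj_on)
    show "finite (open_nbhd G v)"
      using G(1) by (auto simp: open_nbhd_def simple_graph_def)
    have "cl ` open_nbhd G v = {..<3}"
    proof
      show "cl ` open_nbhd G v \<subseteq> {..<3}"
        using range by (auto simp: open_nbhd_def)
      show "{..<3} \<subseteq> cl ` open_nbhd G v"
        using dominating[OF v] by blast
    qed
    then show "card (cl ` open_nbhd G v) = card (open_nbhd G v)"
      using G(2) v by (simp add: cubic_def)
  qed
  have code: "total_perfect_code G (?S c)" if c: "c < 3" for c
    unfolding total_perfect_code_def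
  proof (intro conjI ballI)
    fix v assume v: "v \<in> verts G"
    obtain w where w: "w \<in> open_nbhd G v" "cl w = c"
      using dominating[OF v c] by auto
    then have "open_nbhd G v \<inter> ?S c = {w}"
      using inj[OF v] by (auto simp: inj_on_def open_nbhd_def)
    then show "card (open_nbhd G v \<inter> ?S c) = 1"
      by simp
  qed auto
  have stc: "semi_total_coloring G ?\<mu>"
    unfolding semi_total_coloring_def
  proof (intro conjI ballI impI)
    show "?\<mu> \<in> verts G <+> edges G \<rightarrow> colors"
    proof
      fix x assume x: "x \<in> verts G <+> edges G"
      show "?\<mu> x \<in> colors"
      proof (cases x)
        case (Inl v)
        then show ?thesis
          using x range[of v] by (auto simp: colors_def)
      next
        case (Inr e)
        then have "e \<in> edges G"
          using x by auto
        then obtain v w where "e = {v, w}"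
          using G(1) by (auto simp: simple_graph_def card_2_iff)
        then show ?thesis
          using Inr by (auto simp: tri_coloring_edge colors_def)
      qed
    qed
  next
    fix v e assume v: "v \<in> verts G" and e: "e \<in> edges G" "v \<in> e"
    then obtain w where w: "w \<in> verts G" "e = {v, w}"
      using edgeE by blast
    then show "?\<mu> (Inl v) \<noteq> ?\<mu> (Inr e)"
      using range[OF v] range[OF w(1)] unfolding w(2) tri_coloring_edge tri_coloring_vertex
      by (simp split: if_split) arith
  next
    fix e f assume ef: "e \<in> edges G" "f \<in> edges G" "e \<noteq> f \<and> e \<inter> f \<noteq> {}"
    then obtain v where v: "v \<in> e" "v \<in> f"
      by auto
    obtain a b where a: "a \<in> verts G" "e = {v, a}" and b: "b \<in> verts G" "f = {v, b}"
      using edgeE v ef by meson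
    have vG: "v \<in> verts G"
      using v ef G(1) by (auto simp: simple_graph_def)
    have "cl a \<noteq> cl b"
    proof
      assume "cl a = cl b"
      moreover have "a \<in> open_nbhd G v" "b \<in> open_nbhd G v"
        using a b ef(1,2) by (simp_all add: open_nbhd_def)
      ultimately have "a = b"
        using inj_onD[OF inj[OF vG]] by blast
      then show False
        using a(2) b(2) ef(3) by simp
    qed
    then show "?\<mu> (Inr e) \<noteq> ?\<mu> (Inr f)"
      using range[OF vG] range[OF a(1)] range[OF b(1)] unfolding a(2) b(2) tri_coloring_edge
      by (simp split: if_split) arith
  qed
  have lac: "lacunar G ?\<mu>"
  proof -
    have "\<forall>v\<in>verts G. ?\<mu> (Inl v) \<noteq> 3"
      using range by fastforce
    then show ?thesis
      using stc unfolding lacunar_def colors_def by blast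
  qed
  have nonempty: "?S c \<noteq> {}" if "c < 3" for c
  proof -
    obtain v where "v \<in> verts G"
      using G(3) by blast
    from dominating[OF this that] show ?thesis
      by (auto simp: open_nbhd_def)
  qed
  have classes: "vertex_classes G ?\<mu> = ?S ` {..<3}"
  proof -
    have "vertex_classes G ?\<mu> = ?S ` colors - {{}}"
      unfolding vertex_classes_def tri_coloring_vertex by blast
    also have "colors = insert 3 {..<3}"
      by (auto simp: colors_def)
    also have "?S ` insert 3 {..<3} = insert {} (?S ` {..<3})"
    proof -
      have "?S 3 = {}"
        using range by fastforce
      then show ?thesis
        by (simp only: image_insert)
    qed
    also have "insert {} (?S ` {..<3}) - {{}} = ?S ` {..<3}"
    proof (rule Diff_insert_absorb)
      show "{} \<notin> ?S ` {..<3}"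
        using nonempty by (metis (no_types, lifting) imageE lessThan_iff)
    qed
    finally show ?thesis .
  qed
  have "inj_on ?S {..<3}"
    using nonempty by (intro inj_onI) blast
  then have "card (vertex_classes G ?\<mu>) = 3"
    by (simp add: classes card_image)
  moreover have "?S c = \<Union>{e \<in> beta_edges G ?\<mu>. e \<subseteq> ?S c}" if c: "c < 3" for c
  proof (intro equalityI subsetI)
    fix v assume v: "v \<in> ?S c"
    then obtain w where "w \<in> open_nbhd G v" "cl w = c"
      using dominating[OF _ c] by auto
    with v have "{v, w} \<in> beta_edges G ?\<mu>" "{v, w} \<subseteq> ?S c"
      by (simp_all add: beta_edges_def open_nbhd_def)
    then show "v \<in> \<Union>{e \<in> beta_edges G ?\<mu>. e \<subseteq> ?S c}"
      by blast
  qed auto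
  ultimately show ?thesis
    using lac code unfolding three_total_perfect_def classes by blast
qed


section \<open>Jumble ladders\<close>

lemma jumble_ladder_card:
  assumes "jumble_ladder k G"
  shows "card (verts G) = 6 * k"
  using assms by (auto simp: jumble_ladder_def dest!: bij_betw_same_card)

lemma perfect_matching_partner:
  assumes "perfect_matching_on A M" "v \<in> A"
  shows "\<exists>w\<in>A. {v, w} \<in> M"
proof -
  obtain e where e: "e \<in> M" "v \<in> e" "e \<subseteq> A" "card e = 2"
    using assms by (auto simp: perfect_matching_on_def partition_on_def)
  moreover from this obtain a b where "e = {a, b}"
    by (auto simp: card_2_iff)
  ultimately show ?thesis
    by (metis insertE insert_commute insert_subset singletonD)
qed

text \<open>
  The residue of the position modulo 3 is well defined along the whole cycle because 3 divides its
  length; the matching supplies the neighbor in the own class, the cycle the two others.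
\<close>

lemma jumble_ladder_three_total_perfect:
  assumes "jumble_ladder k G"
  shows "\<exists>\<mu>. three_total_perfect G \<mu>"
proof -
  let ?n = "6 * k"
  let ?A = "\<lambda>x r. x ` {i. i < ?n \<and> i mod 3 = r}"
  obtain x Fu Fv Fw where k: "1 \<le> k" and G: "simple_graph G" "cubic G"
    and x: "bij_betw x {..<?n} (verts G)"
    and F: "perfect_matching_on (?A x 0) Fu" "perfect_matching_on (?A x 1) Fv"
      "perfect_matching_on (?A x 2) Fw"
    and E: "edges G = cycle_edges ?n x \<union> (Fu \<union> Fv \<union> Fw)"
    using assms unfolding jumble_ladder_def by blast
  have FE: "Fu \<subseteq> edges G" "Fv \<subseteq> edges G" "Fw \<subseteq> edges G"
    unfolding E by blast+
  have xV: "x i \<in> verts G" if "i < ?n" for i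
    using x that by (auto simp: bij_betw_def)
  define cl where "cl v = inv_into {..<?n} x v mod 3" for v
  have cl: "cl (x i) = i mod 3" if "i < ?n" for i
    using x that by (simp add: cl_def bij_betw_def)
  have "\<exists>w\<in>open_nbhd G v. cl w = c" if v: "v \<in> verts G" and c: "c < 3" for v c
  proof -
    obtain i where i: "i < ?n" "v = x i"
      using x v by (auto simp: bij_betw_def)
    have same: "\<exists>w\<in>open_nbhd G v. cl w = i mod 3"
    proof -
      have "\<exists>M. perfect_matching_on (?A x (i mod 3)) M \<and> M \<subseteq> edges G"
      proof -
        consider "i mod 3 = 0" | "i mod 3 = 1" | "i mod 3 = 2"
          by linarith
        then show ?thesis
        proof cases
          case 1
          show ?thesis
            unfolding 1 using F(1) FE(1) by blast
        next
          case 2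
          show ?thesis
            unfolding 2 using F(2) FE(2) by blast
        next
          case 3
          show ?thesis
            unfolding 3 using F(3) FE(3) by blast
        qed
      qed
      then obtain M where "perfect_matching_on (?A x (i mod 3)) M" "M \<subseteq> edges G"
        by blast
      moreover have "v \<in> ?A x (i mod 3)"
        using i by blast
      ultimately obtain j where "j < ?n" "j mod 3 = i mod 3" "{v, x j} \<in> edges G"
        using perfect_matching_partner[of "?A x (i mod 3)" M v] by blast
      then have "x j \<in> open_nbhd G v" "cl (x j) = i mod 3"
        using cl xV by (simp_all add: open_nbhd_def)
      then show ?thesis
        by blast
    qed
    have succ: "cl (x (Suc j mod ?n)) = Suc j mod 3"
      "x (Suc j mod ?n) \<in> open_nbhd G (x j)" "x j \<in> open_nbhd G (x (Suc j mod ?n))"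
      if "j < ?n" for j
    proof -
      have lt: "Suc j mod ?n < ?n"
        using k by simp
      have "Suc j mod ?n mod 3 = Suc j mod 3"
        by (rule mod_mod_cancel) simp
      then show "cl (x (Suc j mod ?n)) = Suc j mod 3"
        using cl[OF lt] by simp
      have "{x j, x (Suc j mod ?n)} \<in> edges G"
        unfolding E cycle_edges_def using that by blast
      then show "x (Suc j mod ?n) \<in> open_nbhd G (x j)" "x j \<in> open_nbhd G (x (Suc j mod ?n))"
        using xV[OF lt] xV[OF that] unfolding open_nbhd_def by (simp_all add: insert_commute)
    qed
    \<comment> \<open>the cyclic predecessor of \<open>i\<close>\<close>
    define j where "j = (if i = 0 then ?n - 1 else i - 1)"
    have j: "j < ?n" "Suc j mod ?n = i"
      using i k by (auto simp: j_def)
    have pred: "x j \<in> open_nbhd G v" "cl (x j) = j mod 3" "i mod 3 = Suc j mod 3"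
      using succ(1,3)[OF j(1)] cl[OF j(1)] cl[OF i(1)] unfolding j(2) i(2) by simp_all
    have after: "x (Suc i mod ?n) \<in> open_nbhd G v" "cl (x (Suc i mod ?n)) = Suc i mod 3"
      using succ(1,2)[OF i(1)] unfolding i(2) by simp_all
    have "c = i mod 3 \<or> c = Suc i mod 3 \<or> c = j mod 3"
    proof -
      \<comment> \<open>a residue, its cyclic successor and its cyclic predecessor exhaust the residues modulo 3\<close>
      have "a < 3 \<Longrightarrow> b < 3 \<Longrightarrow> a = (if Suc b = 3 then 0 else Suc b) \<Longrightarrow>
        c = a \<or> c = (if Suc a = 3 then 0 else Suc a) \<or> c = b" for a b :: nat
        using c by (auto split: if_splits)
      from this[of "i mod 3" "j mod 3"] show ?thesis
        using pred(3) unfolding mod_Suc by simp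
    qed
    then show ?thesis
      using same pred(1,2) after by (elim disjE) blast+
  qed
  moreover have "verts G \<noteq> {}"
    using xV[of 0] k by auto
  ultimately show ?thesis
    using tri_coloring_three_total_perfect[OF G, of cl] by (auto simp: cl_def)
qed


section \<open>The six-vertex jumble ladder\<close>

lemma graph_iso_trans:
  assumes "graph_iso G H" "graph_iso H K"
  shows "graph_iso G K"
proof -
  obtain f g where "bij_betw f (verts G) (verts H)" "(`) f ` edges G = edges H"
    "bij_betw g (verts H) (verts K)" "(`) g ` edges H = edges K"
    using assms by (auto simp: graph_iso_def)
  moreover have "(`) (g \<circ> f) ` edges G = (`) g ` (`) f ` edges G"
    by (simp only: image_image comp_def)
  ultimately show ?thesis
    unfolding graph_iso_def using bij_betw_trans[of f _ _ g] by metis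
qed

lemma graph_iso_sym:
  assumes "graph_iso G H" "simple_graph G"
  shows "graph_iso H G"
proof -
  obtain f where f: "bij_betw f (verts G) (verts H)" "(`) f ` edges G = edges H"
    using assms by (auto simp: graph_iso_def)
  let ?g = "inv_into (verts G) f"
  have "?g ` f ` e = e" if "e \<in> edges G" for e
    using that f(1) assms(2) by (auto simp: simple_graph_def bij_betw_def inv_into_image_cancel)
  then have "(`) ?g ` edges H = edges G"
    by (simp add: f(2)[symmetric] image_image)
  then show ?thesis
    using bij_betw_inv_into[OF f(1)] by (auto simp: graph_iso_def)
qed

text \<open>
  The enumeration \<open>x\<close> is itself the isomorphism.
\<close>

lemma mobius_ladder_iso:
  assumes "bij_betw x {..<2 * r} (verts G)"
    and "edges G = cycle_edges (2 * r) x \<union> {{x i, x (i + r)} | i. i < r}"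
  shows "graph_iso (mobius_ladder r) G"
proof -
  have "(`) x ` edges (mobius_ladder r) = edges G"
    unfolding assms(2)
    by (auto simp: mobius_ladder_def cycle_edges_def image_Un setcompr_eq_image image_image)
  then show ?thesis
    using assms(1) by (auto simp: graph_iso_def mobius_ladder_def)
qed

lemma perfect_matching_on_pair:
  assumes "a \<noteq> b"
  shows "perfect_matching_on {a, b} M \<longleftrightarrow> M = {{a, b}}"
proof
  assume M: "perfect_matching_on {a, b} M"
  have "e = {a, b}" if "e \<in> M" for e
    using M that assms
    by (intro card_subset_eq) (auto simp: perfect_matching_on_def partition_on_def)
  moreover have "M \<noteq> {}"
    using M by (auto simp: perfect_matching_on_def partition_on_def)
  ultimately show "M = {{a, b}}"
    by auto
qed (use assms in \<open>auto simp: perfect_matching_on_def partition_on_def\<close>)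

lemma positions_mod_3:
  "{i. i < 6 \<and> i mod 3 = 0} = {0, 3::nat}"
  "{i. i < 6 \<and> i mod 3 = 1} = {1, 4::nat}"
  "{i. i < 6 \<and> i mod 3 = 2} = {2, 5::nat}"
  by (presburger | (intro set_eqI; simp; presburger))+

text \<open>
  With two vertices in each class the three matchings are forced, and the two positions in a class
  are opposite on the cycle.
\<close>

lemma jumble_ladder_1_iff:
  fixes G :: "'a graph"
  shows "jumble_ladder 1 G \<longleftrightarrow> simple_graph G \<and> cubic G \<and>
     (\<exists>x. bij_betw x {..<6} (verts G) \<and>
          edges G = cycle_edges 6 x \<union> {{x i, x (i + 3)} | i. i < 3})"
proof -
  have pairs: "{{x i, x (i + 3)} | i. i < 3} = {{x 0, x 3}} \<union> {{x 1, x 4}} \<union> {{x 2, x 5}}"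
    for x :: "nat \<Rightarrow> 'a"
    by (auto simp: less_Suc_eq numeral_3_eq_3 numeral_eq_Suc)
  have "perfect_matching_on (x ` {i. i < 6 \<and> i mod 3 = 0}) M \<longleftrightarrow> M = {{x 0, x 3}}"
    "perfect_matching_on (x ` {i. i < 6 \<and> i mod 3 = 1}) M \<longleftrightarrow> M = {{x 1, x 4}}"
    "perfect_matching_on (x ` {i. i < 6 \<and> i mod 3 = 2}) M \<longleftrightarrow> M = {{x 2, x 5}}"
    if "bij_betw x {..<6} (verts G)" for x :: "nat \<Rightarrow> 'a" and M
    using that unfolding positions_mod_3
    by (auto simp: perfect_matching_on_pair bij_betw_def inj_on_eq_iff)
  then show ?thesis
    unfolding jumble_ladder_def pairs by auto
qed

lemma jumble_ladder_1_iso_mobius_ladder: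
  assumes "jumble_ladder 1 G"
  shows "graph_iso (mobius_ladder 3) G"
  using assms mobius_ladder_iso[of _ 3 G] unfolding jumble_ladder_1_iff by auto

lemma cubic_complete_bipartite_3_3: "cubic (complete_bipartite 3 3)"
proof -
  have "open_nbhd (complete_bipartite 3 3) (Inl i) = Inr ` {..<3}"
    "open_nbhd (complete_bipartite 3 3) (Inr i) = Inl ` {..<3}" if "i < 3" for i
    using that by (auto simp: open_nbhd_def complete_bipartite_def doubleton_eq_iff)
  then show ?thesis
    by (auto simp: cubic_def card_image complete_bipartite_def)
qed

lemma jumble_ladder_complete_bipartite_3_3: "jumble_ladder 1 (complete_bipartite 3 3)"
proof -
  let ?K = "complete_bipartite 3 3"
  \<comment> \<open>a hexagon alternating between the two sides; positions \<open>i\<close> and \<open>i + 3\<close> differ in parity\<close>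
  define x :: "nat \<Rightarrow> nat + nat" where
    "x i = (if even i then Inl (i div 2) else Inr (i div 2))" for i
  have six: "{..<6} = {0, 1, 2, 3, 4, 5::nat}" and three: "{..<3} = {0, 1, 2::nat}"
    by auto
  have "inj_on x {..<6}"
    by (auto simp: inj_on_def x_def split: if_splits elim!: evenE oddE)
  moreover have "x ` {..<6} = verts ?K"
    unfolding six by (auto simp: x_def complete_bipartite_def three Plus_def)
  moreover have "simple_graph ?K"
    by (auto simp: simple_graph_def complete_bipartite_def)
  moreover have "edges ?K = cycle_edges 6 x \<union> {{x i, x (i + 3)} | i. i < 3}"
  proof -
    have "edges ?K = (\<lambda>(i, j). {Inl i, Inr j}) ` ({..<3} \<times> {..<3})"
      by (auto simp: complete_bipartite_def)
    moreover have "cycle_edges 6 x = (\<lambda>i. {x i, x (Suc i mod 6)}) ` {..<6}"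
      by (auto simp: cycle_edges_def)
    moreover have "{{x i, x (i + 3)} | i. i < 3} = (\<lambda>i. {x i, x (i + 3)}) ` {..<3}"
      by auto
    ultimately show ?thesis
      unfolding six three by (simp add: x_def insert_commute)
  qed
  ultimately show ?thesis
    unfolding jumble_ladder_1_iff bij_betw_def using cubic_complete_bipartite_3_3 by blast
qed

theorem theorem36:
  fixes k :: nat and G :: "'a graph"
  assumes "k \<ge> 1" and "jumble_ladder k G"
  shows "(\<exists>\<mu>. three_total_perfect G \<mu> \<and>
              \<not> (\<exists>\<mu>'. beta_reduction G \<mu> \<mu>' \<and> total_coloring G \<mu>'))
       \<and> (\<forall>\<mu>. three_total_perfect G \<mu> \<and> equitable G \<mu> \<longrightarrow> k = 1)
       \<and> ((\<exists>\<mu>. three_total_perfect G \<mu> \<and> equitable G \<mu>)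
            \<longleftrightarrow> graph_iso G (complete_bipartite 3 3))
       \<and> jumble_ladder 1 (complete_bipartite 3 3)
       \<and> graph_iso (complete_bipartite 3 3) (mobius_ladder 3)"
proof -
  let ?K = "complete_bipartite 3 3"
  have G: "simple_graph G" "cubic G"
    using assms(2) by (auto simp: jumble_ladder_def)
  have simpleM: "simple_graph (mobius_ladder 3)"
  proof -
    have "Suc i mod 6 \<noteq> i" for i :: nat
      by presburger
    then show ?thesis
      by (auto simp: simple_graph_def mobius_ladder_def cycle_edges_def eq_commute)
  qed
  note MK = jumble_ladder_1_iso_mobius_ladder[OF jumble_ladder_complete_bipartite_3_3]
  note KM = graph_iso_sym[OF MK simpleM]
  obtain \<mu> where \<mu>: "three_total_perfect G \<mu>"
    using jumble_ladder_three_total_perfect[OF assms(2)] by auto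
  have eq: "equitable G \<nu> \<longleftrightarrow> k = 1" if "three_total_perfect G \<nu>" for \<nu>
    using three_total_perfect_equitable_iff[OF G that jumble_ladder_card[OF assms(2)] assms(1)] .
  have iso: "graph_iso G ?K \<longleftrightarrow> k = 1"
  proof
    assume "k = 1"
    then have "graph_iso (mobius_ladder 3) G"
      using assms(2) jumble_ladder_1_iso_mobius_ladder by blast
    then show "graph_iso G ?K"
      using graph_iso_trans[OF graph_iso_sym[OF _ simpleM] MK] by blast
  next
    assume that: "graph_iso G ?K"
    have "card (verts G) = card (verts ?K)"
      using that by (auto simp: graph_iso_def dest: bij_betw_same_card)
    then show "k = 1"
      using jumble_ladder_card[OF assms(2)]
        jumble_ladder_card[OF jumble_ladder_complete_bipartite_3_3] by simp
  qed
  show ?thesis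
  proof (intro conjI)
    show "\<exists>\<mu>. three_total_perfect G \<mu> \<and>
        \<not> (\<exists>\<mu>'. beta_reduction G \<mu> \<mu>' \<and> total_coloring G \<mu>')"
      using \<mu> three_total_perfect_no_total_reduction[OF G(1) \<mu>] by blast
    show "\<forall>\<mu>. three_total_perfect G \<mu> \<and> equitable G \<mu> \<longrightarrow> k = 1"
      using eq by blast
    show "(\<exists>\<mu>. three_total_perfect G \<mu> \<and> equitable G \<mu>) \<longleftrightarrow> graph_iso G ?K"
      using \<mu> eq iso by blast
  qed (fact jumble_ladder_complete_bipartite_3_3 KM)+
qed

end
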